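(* Let $F$ be a supertropical semifield and let $V=(V,\mathcal H_0)$ be a supertropical vector space over $F$. Suppose $V$ has an s-base $S$. Then $S$ is precisely the tropical critical set of $V$ (up to the choice of representatives); that is, every element of $S$ is critical, and every critical vector of $V$ is projectively equivalent to exactly one element of $S$.
   Context: A semiring with ghosts is a triple $(R,\mathcal G_0,\nu)$ where $R$ is a semiring with $0,1$ such that $R\setminus\{0\}$ is closed under addition and multiplication, $\mathcal G_0\ni 0$ is an ideal (the ghost ideal), and $\nu:R\to\mathcal G_0$, $\nu(a)=a+a=:a^\nu$, is idempotent and preserves addition and multiplication. Put $e=1^\nu$, $\mathcal G=\mathcal G_0\setminus\{0\}$. It is a supertropical semiring if for nonzero $a,b$: $a+b=a^\nu$ whenever $a^\nu=b^\nu$, and $a+b\in\{a,b\}$ whenever $a^\nu\neq b^\nu$. It is a supertropical domain if $\mathcal T:=R\setminus\mathcal G_0$ (the tangible elements) is a multiplicative monoid and $\nu|_{\mathcal T}:\mathcal T\to\mathcal G$ is onto, and a supertropical semifield if moreover $\mathcal T$ is a group. A supertropical vector space over a supertropical semifield $F$ is a pair $(V,\mathcal H_0)$ where $V$ is an $F$-module (commutative additive monoid with zero $0_V$ and scalar multiplication satisfying the usual module axioms over a semiring, including $r0_V=0_V$ and $0v=0_V$) and $\mathcal H_0\supseteq eV$ is a submodule (the ghost submodule), such that, with $v^\nu:=v+v=ev$, $v^\nu=w^\nu$ implies $v+w=v^\nu$. Write $v\models_{gs}w$ ("$v$ ghost surpasses $w$") if $v=w+h$ for some $h\in\mathcal H_0$.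 A vector $v$ is tropically spanned by $S\subset V$ if $v\models_{gs}\sum_{i\in I'}\alpha_iw_i$ for some finite (possibly empty, with empty sum $0_V$) collection of elements $w_i\in S$ and $\alpha_i\in\mathcal T$. $S$ tropically spans $V$ if every $v\in V$ is tropically spanned by $S$. An s-base of $V$ is a subset $S$ of $V$ that tropically spans $V$ and such that no proper subset of $S$ tropically spans $V$. Vectors $v,w$ are projectively equivalent, $v\sim w$, if $v=\alpha w$ for some $\alpha\in\mathcal T$; $[v]_\sim$ denotes the class of $v$. A nonzero vector $v$ is critical if one cannot write $v\models_{gs}v_1+v_2$ with $v_1,v_2\in V\setminus[v]_\sim$. A tropical critical set of $V$ is a set of representatives, one from each projective equivalence class, of all critical vectors of $V$. *)

theory Defs
  imports Main
begin

text \<open>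
  The semiring is the whole type \<open>'r\<close>. Multiplication is not assumed commutative. Class
  \<open>semiring_1\<close> includes \<open>0 \<noteq> 1\<close>; this is no restriction for supertropical domains, where
  \<open>1\<close> lies outside the ghost ideal and \<open>0\<close> inside.
\<close>

definition ghost_map :: "'a::plus \<Rightarrow> 'a"
  where "ghost_map a = a + a"

locale semiring_with_ghosts =
  fixes G0 :: "'r::semiring_1 set"
  assumes add_nonzero: "\<And>a b::'r. a \<noteq> 0 \<Longrightarrow> b \<noteq> 0 \<Longrightarrow> a + b \<noteq> 0"
    and mult_nonzero: "\<And>a b::'r. a \<noteq> 0 \<Longrightarrow> b \<noteq> 0 \<Longrightarrow> a * b \<noteq> 0"
    and zero_ghost: "0 \<in> G0"
    and add_ghost: "\<And>a b. a \<in> G0 \<Longrightarrow> b \<in> G0 \<Longrightarrow> a + b \<in> G0"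
    and mult_ghost_left: "\<And>r a. a \<in> G0 \<Longrightarrow> r * a \<in> G0"
    and mult_ghost_right: "\<And>r a. a \<in> G0 \<Longrightarrow> a * r \<in> G0"
    and ghost_map_ghost: "\<And>a. ghost_map a \<in> G0"
    and ghost_map_idem: "\<And>a::'r. ghost_map (ghost_map a) = ghost_map a"
    and ghost_map_add: "\<And>a b::'r. ghost_map (a + b) = ghost_map a + ghost_map b"
    and ghost_map_mult: "\<And>a b::'r. ghost_map (a * b) = ghost_map a * ghost_map b"
begin

definition tangible :: "'r set"
  where "tangible = - G0"

end

locale supertropical_semiring = semiring_with_ghosts +
  assumes add_eq_ghost:
      "\<And>a b::'a. a \<noteq> 0 \<Longrightarrow> b \<noteq> 0 \<Longrightarrow> ghost_map a = ghost_map b \<Longrightarrow> a + b = ghost_map a"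
    and add_bipotent:
      "\<And>a b::'a. a \<noteq> 0 \<Longrightarrow> b \<noteq> 0 \<Longrightarrow> ghost_map a \<noteq> ghost_map b \<Longrightarrow> a + b \<in> {a, b}"

locale supertropical_domain = supertropical_semiring +
  assumes one_tangible: "1 \<in> tangible"
    and mult_tangible: "\<And>a b. a \<in> tangible \<Longrightarrow> b \<in> tangible \<Longrightarrow> a * b \<in> tangible"
    and ghost_map_onto: "ghost_map ` tangible = G0 - {0}"

locale supertropical_semifield = supertropical_domain +
  assumes inverse_tangible:
    "\<And>a. a \<in> tangible \<Longrightarrow> \<exists>b\<in>tangible. a * b = 1 \<and> b * a = 1"

locale supertropical_vector_space = supertropical_semifield G0
  for G0 :: "'f::semiring_1 set" +
  fixes scale :: "'f \<Rightarrow> 'v::comm_monoid_add \<Rightarrow> 'v"  (infixr \<open>*s\<close> 75)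
    and H0 :: "'v set"
  assumes scale_add_right: "\<And>r v w. r *s (v + w) = r *s v + r *s w"
    and scale_add_left: "\<And>r s v. (r + s) *s v = r *s v + s *s v"
    and scale_scale: "\<And>r s v. (r * s) *s v = r *s (s *s v)"
    and scale_one: "\<And>v. 1 *s v = v"
    and scale_zero_right: "\<And>r. r *s 0 = 0"
    and scale_zero_left: "\<And>v. 0 *s v = 0"
    and zero_ghost_vec: "0 \<in> H0"
    and add_ghost_vec: "\<And>v w. v \<in> H0 \<Longrightarrow> w \<in> H0 \<Longrightarrow> v + w \<in> H0"
    and scale_ghost_vec: "\<And>r v. v \<in> H0 \<Longrightarrow> r *s v \<in> H0"
    and e_scale_ghost: "\<And>v. ghost_map 1 *s v \<in> H0"
    and add_eq_ghost_vec: "\<And>v w::'v. ghost_map v = ghost_map w \<Longrightarrow> v + w = ghost_map v"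
begin

definition ghost_surpasses :: "'v \<Rightarrow> 'v \<Rightarrow> bool"
  where "ghost_surpasses v w \<longleftrightarrow> (\<exists>h\<in>H0. v = w + h)"

text \<open>All coefficients are tangible, in particular nonzero; the index set may be empty.\<close>

definition tropically_spanned :: "'v set \<Rightarrow> 'v \<Rightarrow> bool"
  where "tropically_spanned S v \<longleftrightarrow>
    (\<exists>I \<alpha>. finite I \<and> I \<subseteq> S \<and> (\<forall>w\<in>I. \<alpha> w \<in> tangible) \<and>
      ghost_surpasses v (\<Sum>w\<in>I. \<alpha> w *s w))"

definition tropically_spans :: "'v set \<Rightarrow> bool"
  where "tropically_spans S \<longleftrightarrow> (\<forall>v. tropically_spanned S v)"

definition s_base :: "'v set \<Rightarrow> bool"
  where "s_base S \<longleftrightarrow> tropically_spans S \<and> (\<forall>S'. S' \<subset> S \<longrightarrow> \<not> tropically_spans S')"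

definition proj_equiv :: "'v \<Rightarrow> 'v \<Rightarrow> bool"
  where "proj_equiv v w \<longleftrightarrow> (\<exists>\<alpha>\<in>tangible. v = \<alpha> *s w)"

definition proj_class :: "'v \<Rightarrow> 'v set"
  where "proj_class v = {w. proj_equiv w v}"

definition critical :: "'v \<Rightarrow> bool"
  where "critical v \<longleftrightarrow> v \<noteq> 0 \<and>
    \<not> (\<exists>v1 v2. v1 \<notin> proj_class v \<and> v2 \<notin> proj_class v \<and> ghost_surpasses v (v1 + v2))"

text \<open>
  A tropical critical set is determined only up to the choice of representatives, so it is a
  predicate on sets of vectors.
\<close>

definition tropical_critical_set :: "'v set \<Rightarrow> bool"
  where "tropical_critical_set C \<longleftrightarrow>
    C \<subseteq> Collect critical \<and>
    (\<forall>X \<in> proj_class ` Collect critical. \<exists>!c. c \<in> C \<inter> X)"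

end

end

theory Submission
  imports Defs
begin

text \<open>
  Write \<open>\<nu>\<close> for \<open>ghost_map\<close>. Adding scalars is almost a choice of the larger one, and this lets
  an equation \<open>s = \<gamma> *s s + u\<close> be analysed although nothing can be subtracted. A ghost \<open>\<gamma>\<close> makes
  \<open>s\<close> ghost surpass \<open>u\<close>. So does a tangible \<open>\<gamma>\<close> dominated by \<open>1\<close>: then \<open>s + \<gamma> *s s = s\<close>, which
  puts the ghost \<open>\<gamma> *s s + \<gamma> *s s\<close> in place of \<open>\<gamma> *s s\<close>. If a tangible \<open>\<gamma>\<close> dominates \<open>1\<close>, then \<open>s\<close>
  itself is ghost. So, when \<open>u\<close> is spanned by vectors that do not span \<open>s\<close>, the coefficient is
  tangible with \<open>\<nu> \<gamma> = \<nu> 1\<close> (\<open>self_coefficient\<close>). In that case every summand \<open>a\<close> of \<open>u\<close> is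
  absorbed: \<open>\<gamma> *s s + a = \<gamma> *s s\<close> (\<open>summand_absorbed\<close>).

  An element \<open>s\<close> of an s-base \<open>S\<close> is not spanned by the remaining elements. Suppose that \<open>s\<close>
  ghost surpasses \<open>v1 + v2\<close>, and expand \<open>v1 = \<alpha> *s s + u1\<close> and \<open>v2 = \<beta> *s s + u2\<close> with \<open>u1\<close>, \<open>u2\<close>
  spanned by \<open>S - {s}\<close>. Then \<open>s = (\<alpha> + \<beta>) *s s + u\<close>, hence \<open>\<alpha> + \<beta>\<close> is tangible, so bipotence
  makes it equal to \<open>\<alpha>\<close> or to \<open>\<beta>\<close>; absorption then gives \<open>v1 = \<alpha> *s s\<close> or \<open>v2 = \<beta> *s s\<close>. Thus \<open>s\<close>
  is critical.

  Conversely, a critical \<open>v\<close> that ghost surpasses a tangible combination of elements of \<open>S\<close> can be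
  separated from one summand at a time: criticality forces either the summand or the rest to be
  equivalent to \<open>v\<close>, and rescaling the rest gives a shorter combination. The empty one would make
  \<open>v\<close> ghost, which a critical vector cannot be. Finally, equivalent elements of an s-base are equal,
  as each is spanned by the other.
\<close>

context supertropical_vector_space
begin

section \<open>Ghosts and projective equivalence\<close>

lemma ghost_map_vec: "ghost_map v = ghost_map 1 *s (v::'v)"
  by (simp only: ghost_map_def scale_add_left scale_one)

lemma double_ghost: "v + v \<in> H0"
  using e_scale_ghost[of v] ghost_map_vec[of v] by (simp add: ghost_map_def)

lemma ghost_map_vec_idem: "ghost_map (ghost_map v) = ghost_map (v::'v)"
proof -
  have "ghost_map (ghost_map v) = ghost_map (ghost_map 1) *s v"
    by (simp only: ghost_map_def scale_add_left scale_one)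
  then show ?thesis
    by (metis ghost_map_idem ghost_map_vec)
qed

lemma add_ghost_map_self: "v + ghost_map v = ghost_map (v::'v)"
  by (metis add_eq_ghost_vec ghost_map_vec_idem)

lemma ghost_scalar:
  assumes "g \<in> G0"
  shows "g *s v \<in> H0"
proof (cases "g = 0")
  case True
  then show ?thesis by (simp add: scale_zero_left zero_ghost_vec)
next
  case False
  then obtain t where "g = ghost_map t"
    using assms ghost_map_onto by blast
  then show ?thesis
    using double_ghost[of "t *s v"] by (simp add: ghost_map_def scale_add_left)
qed

lemma tangible_nonzero: "a \<in> tangible \<Longrightarrow> a \<noteq> 0"
  using zero_ghost by (auto simp: tangible_def)

lemma tangible_scale_cancel:
  assumes "a \<in> tangible"
  obtains b where "b \<in> tangible" "\<And>v. a *s (b *s v) = v" "\<And>v. b *s (a *s v) = v"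
  using inverse_tangible[OF assms] by (metis scale_one scale_scale)

lemma scale_sum_right: "r *s (\<Sum>w\<in>I. f w) = (\<Sum>w\<in>I. r *s f w)"
  by (induction I rule: infinite_finite_induct) (simp_all add: scale_zero_right scale_add_right)

lemma proj_equiv_sym: "proj_equiv v w \<Longrightarrow> proj_equiv w v"
  unfolding proj_equiv_def by (metis tangible_scale_cancel)

lemma proj_equiv_trans: "proj_equiv u v \<Longrightarrow> proj_equiv v w \<Longrightarrow> proj_equiv u w"
  unfolding proj_equiv_def by (metis mult_tangible scale_scale)

section \<open>Tropical spans are submodules\<close>

text \<open>
  A term with a ghost coefficient is itself ghost and disappears in the ghost surplus. Spans are
  therefore closed under addition, although a sum of tangible coefficients may be ghost.
\<close>

lemma tropically_spanned_arbitrary_coefficients: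
  assumes "finite I" "I \<subseteq> S" "h \<in> H0"
  shows "tropically_spanned S ((\<Sum>w\<in>I. c w *s w) + h)"
proof -
  define J where "J = {w\<in>I. c w \<in> tangible}"
  have split: "(\<Sum>w\<in>I. c w *s w) = (\<Sum>w\<in>J. c w *s w) + (\<Sum>w\<in>I - J. c w *s w)"
    using sum.subset_diff[of J I "\<lambda>w. c w *s w"] assms(1) by (auto simp: J_def add.commute)
  have "(\<Sum>w\<in>K. c w *s w) \<in> H0" if "finite K" "K \<subseteq> I - J" for K
    using that
    by (induction K rule: finite_induct)
       (auto simp: zero_ghost_vec J_def tangible_def intro: add_ghost_vec ghost_scalar)
  then have "(\<Sum>w\<in>I - J. c w *s w) + h \<in> H0"
    using assms(1,3) by (blast intro: add_ghost_vec)
  then have "ghost_surpasses ((\<Sum>w\<in>J. c w *s w) + ((\<Sum>w\<in>I - J. c w *s w) + h))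
      (\<Sum>w\<in>J. c w *s w)"
    unfolding ghost_surpasses_def by blast
  then have "ghost_surpasses ((\<Sum>w\<in>I. c w *s w) + h) (\<Sum>w\<in>J. c w *s w)"
    by (simp only: split add.assoc)
  moreover have "finite J" "J \<subseteq> S" "\<forall>w\<in>J. c w \<in> tangible"
    using assms(1,2) by (auto simp: J_def)
  ultimately show ?thesis
    unfolding tropically_spanned_def by blast
qed

lemma tropically_spannedE:
  assumes "tropically_spanned S v"
  obtains I c h where "finite I" "I \<subseteq> S" "h \<in> H0" "v = (\<Sum>w\<in>I. c w *s w) + h"
  using assms unfolding tropically_spanned_def ghost_surpasses_def by blast

lemma tropically_spanned_ghost: "h \<in> H0 \<Longrightarrow> tropically_spanned S h"
  using tropically_spanned_arbitrary_coefficients[of "{}"] by simp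

lemma tropically_spanned_member: "w \<in> S \<Longrightarrow> tropically_spanned S w"
  using tropically_spanned_arbitrary_coefficients[of "{w}" S 0 "\<lambda>_. 1"]
  by (simp add: scale_one zero_ghost_vec)

lemma tropically_spanned_scale:
  assumes "tropically_spanned S v"
  shows "tropically_spanned S (r *s v)"
proof -
  obtain I c h where I: "finite I" "I \<subseteq> S" "h \<in> H0" "v = (\<Sum>w\<in>I. c w *s w) + h"
    using assms by (rule tropically_spannedE)
  have "r *s v = (\<Sum>w\<in>I. (r * c w) *s w) + r *s h"
    by (simp add: I(4) scale_add_right scale_sum_right scale_scale)
  then show ?thesis
    using tropically_spanned_arbitrary_coefficients I(1-3) scale_ghost_vec by simp
qed

lemma tropically_spanned_add:
  assumes "tropically_spanned S v" "tropically_spanned S w"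
  shows "tropically_spanned S (v + w)"
proof -
  obtain I c h where I: "finite I" "I \<subseteq> S" "h \<in> H0" "v = (\<Sum>x\<in>I. c x *s x) + h"
    using assms(1) by (rule tropically_spannedE)
  obtain J d k where J: "finite J" "J \<subseteq> S" "k \<in> H0" "w = (\<Sum>x\<in>J. d x *s x) + k"
    using assms(2) by (rule tropically_spannedE)
  define c' where "c' x = (if x \<in> I then c x else 0)" for x
  define d' where "d' x = (if x \<in> J then d x else 0)" for x
  have "(\<Sum>x\<in>I. c x *s x) = (\<Sum>x\<in>I \<union> J. c' x *s x)"
    using I(1) J(1) by (intro sum.mono_neutral_cong_left) (auto simp: c'_def scale_zero_left)
  moreover have "(\<Sum>x\<in>J. d x *s x) = (\<Sum>x\<in>I \<union> J. d' x *s x)"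
    using I(1) J(1) by (intro sum.mono_neutral_cong_left) (auto simp: d'_def scale_zero_left)
  ultimately have "v + w = (\<Sum>x\<in>I \<union> J. (c' x + d' x) *s x) + (h + k)"
    by (simp add: I(4) J(4) scale_add_left sum.distrib ac_simps)
  then show ?thesis
    using tropically_spanned_arbitrary_coefficients[of "I \<union> J" S] I(1-3) J(1-3) add_ghost_vec
    by simp
qed

lemma tropically_spanned_trans:
  assumes "tropically_spanned S v" "\<And>w. w \<in> S \<Longrightarrow> tropically_spanned T w"
  shows "tropically_spanned T v"
proof -
  obtain I c h where I: "finite I" "I \<subseteq> S" "h \<in> H0" "v = (\<Sum>w\<in>I. c w *s w) + h"
    using assms(1) by (rule tropically_spannedE)
  have "tropically_spanned T (\<Sum>w\<in>I. c w *s w)"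
    using I(1,2)
    by (induction I rule: finite_induct)
       (auto intro: tropically_spanned_ghost zero_ghost_vec tropically_spanned_add
          tropically_spanned_scale assms(2))
  then show ?thesis
    using I(3,4) by (simp add: tropically_spanned_add tropically_spanned_ghost)
qed

lemma s_base_not_redundant:
  assumes "s_base S" "s \<in> S"
  shows "\<not> tropically_spanned (S - {s}) s"
proof
  assume redundant: "tropically_spanned (S - {s}) s"
  have "tropically_spanned (S - {s}) w" if "w \<in> S" for w
    using that redundant tropically_spanned_member by (cases "w = s") auto
  then have "tropically_spans (S - {s})"
    using assms(1) tropically_spanned_trans unfolding s_base_def tropically_spans_def by blast
  moreover have "S - {s} \<subset> S"
    using assms(2) by blast
  ultimately show False
    using assms(1) unfolding s_base_def by blast
qed

lemma s_base_proj_equiv_eq: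
  assumes "s_base S" "s \<in> S" "t \<in> S" "proj_equiv s t"
  shows "s = t"
proof (rule ccontr)
  assume "s \<noteq> t"
  then have "tropically_spanned (S - {s}) t"
    using assms(3) by (auto intro: tropically_spanned_member)
  then have "tropically_spanned (S - {s}) s"
    using assms(4) tropically_spanned_scale unfolding proj_equiv_def by metis
  then show False
    using s_base_not_redundant assms by blast
qed

lemma split_coefficient:
  assumes "tropically_spanned S v"
  obtains a u where "v = a *s s + u" "tropically_spanned (S - {s}) u"
proof -
  obtain I c h where I: "finite I" "I \<subseteq> S" "h \<in> H0" "v = (\<Sum>w\<in>I. c w *s w) + h"
    using assms by (rule tropically_spannedE)
  define u where "u = (\<Sum>w\<in>I - {s}. c w *s w) + h"
  have "tropically_spanned (S - {s}) u"
    unfolding u_def using I(1-3) by (auto intro!: tropically_spanned_arbitrary_coefficients)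
  moreover have "v = (if s \<in> I then c s else 0) *s s + u"
    using I(1,4) sum.remove[of I s "\<lambda>w. c w *s w"]
    by (auto simp: u_def scale_zero_left add.assoc)
  ultimately show ?thesis
    using that by blast
qed

section \<open>The equation \<open>s = \<gamma> *s s + u\<close>\<close>

text \<open>
  A ghost coefficient only adds a ghost to \<open>u\<close>. For a tangible \<open>\<gamma>\<close> with a ghost different from that
  of \<open>1\<close>, bipotence makes \<open>\<gamma> + 1\<close> one of \<open>1\<close> and \<open>\<gamma>\<close>, and either way \<open>s\<close> becomes spanned by \<open>T\<close>.
\<close>

lemma self_coefficient:
  assumes eq: "s = \<gamma> *s s + u"
    and u: "tropically_spanned T u"
    and s: "\<not> tropically_spanned T s"
  shows "\<gamma> \<in> tangible" "ghost_map \<gamma> = ghost_map 1"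
proof -
  show tangible: "\<gamma> \<in> tangible"
  proof (rule ccontr)
    assume "\<gamma> \<notin> tangible"
    then have "\<gamma> *s s \<in> H0"
      by (simp add: tangible_def ghost_scalar)
    then show False
      using s u tropically_spanned_add[OF tropically_spanned_ghost] eq by metis
  qed
  show "ghost_map \<gamma> = ghost_map 1"
  proof (rule ccontr)
    assume "ghost_map \<gamma> \<noteq> ghost_map 1"
    then have "\<gamma> + 1 \<in> {\<gamma>, 1}"
      using add_bipotent tangible_nonzero[OF tangible] by simp
    then show False
    proof (elim insertE emptyE)
      assume "\<gamma> + 1 = 1"
      then have "s = \<gamma> *s s + s"
        by (metis scale_add_left scale_one)
      then have "s = (\<gamma> *s s + \<gamma> *s s) + u"
        using eq by (metis add.assoc)
      then show False
        using s u tropically_spanned_add[OF tropically_spanned_ghost[OF double_ghost]] by metis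
    next
      assume "\<gamma> + 1 = \<gamma>"
      then have dom: "\<gamma> *s s = \<gamma> *s s + s"
        by (metis scale_add_left scale_one)
      \<comment> \<open>Idempotence turns \<open>eq\<close> and \<open>dom\<close> into opposite inequalities between the ghosts.\<close>
      have "ghost_map (\<gamma> *s s) = ghost_map (\<gamma> *s s) + ghost_map s"
        using dom by (metis ghost_map_vec scale_add_right)
      also have "\<dots> = ghost_map (\<gamma> *s s) + (ghost_map (\<gamma> *s s) + ghost_map u)"
        using eq by (metis ghost_map_vec scale_add_right)
      also have "\<dots> = ghost_map (\<gamma> *s s) + ghost_map u"
        using ghost_map_vec_idem[of "\<gamma> *s s"] by (metis add.assoc ghost_map_def)
      also have "\<dots> = ghost_map s"
        using eq by (metis ghost_map_vec scale_add_right)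
      finally have "\<gamma> *s s + s = ghost_map (\<gamma> *s s)"
        by (rule add_eq_ghost_vec)
      then have "\<gamma> *s s \<in> H0"
        using dom double_ghost by (metis ghost_map_def)
      then have "s \<in> H0"
        using tangible_scale_cancel[OF tangible] scale_ghost_vec by metis
      then show False
        using s tropically_spanned_ghost by blast
    qed
  qed
qed

text \<open>
  Substituting the equation into itself turns the surplus into \<open>(\<gamma> + 1) *s (a + x)\<close>, which is the
  ghost of \<open>a + x\<close>. Ghosts are additively idempotent, so \<open>s\<close> absorbs the ghost of \<open>a\<close>, and that
  ghost absorbs \<open>a\<close>.
\<close>

lemma summand_absorbed:
  assumes eq: "s = \<gamma> *s s + (a + x)"
    and \<gamma>: "\<gamma> \<noteq> 0" "ghost_map \<gamma> = ghost_map 1"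
  shows "\<gamma> *s s + a = \<gamma> *s s"
proof -
  have sum: "\<gamma> + 1 = ghost_map 1"
    using add_eq_ghost[of \<gamma> 1] \<gamma> by simp
  have "s = \<gamma> *s (\<gamma> *s s + (a + x)) + (a + x)"
    using eq by metis
  also have "\<dots> = \<gamma> *s \<gamma> *s s + (\<gamma> + 1) *s (a + x)"
    by (simp add: scale_add_right scale_add_left scale_one ac_simps)
  finally have s: "s = \<gamma> *s \<gamma> *s s + (ghost_map a + ghost_map x)"
    by (simp only: sum ghost_map_vec scale_add_right)
  have idem: "ghost_map a + ghost_map a = ghost_map a"
    using ghost_map_vec_idem[of a] by (simp add: ghost_map_def)
  have "s + ghost_map a
      = \<gamma> *s \<gamma> *s s + ((ghost_map a + ghost_map a) + ghost_map x)"
    by (subst s) (simp only: ac_simps)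
  then have "s + ghost_map a = s"
    using s idem by simp
  then have "\<gamma> *s s + \<gamma> *s ghost_map a = \<gamma> *s s"
    by (metis scale_add_right)
  moreover have "\<gamma> *s ghost_map a = ghost_map \<gamma> *s a"
    by (simp add: ghost_map_def scale_add_left scale_add_right)
  ultimately have absorbs: "\<gamma> *s s + ghost_map a = \<gamma> *s s"
    using \<gamma>(2) ghost_map_vec[of a] by simp
  then have "\<gamma> *s s + a = \<gamma> *s s + (a + ghost_map a)"
    by (metis add.assoc add.commute)
  then show ?thesis
    using absorbs add_ghost_map_self[of a] by simp
qed

section \<open>Critical vectors and s-bases\<close>

lemma s_base_element_critical:
  assumes base: "s_base S" and s: "s \<in> S"
  shows "critical s"
  unfolding critical_def
proof (intro conjI notI)
  note indep = s_base_not_redundant[OF base s]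
  show False if "s = 0"
    using indep tropically_spanned_ghost[OF zero_ghost_vec] that by simp
  assume "\<exists>v1 v2. v1 \<notin> proj_class s \<and> v2 \<notin> proj_class s \<and> ghost_surpasses s (v1 + v2)"
  then obtain v1 v2 h where v: "\<not> proj_equiv v1 s" "\<not> proj_equiv v2 s"
    and h: "h \<in> H0" "s = v1 + v2 + h"
    by (auto simp: proj_class_def ghost_surpasses_def)
  have spans: "tropically_spanned S v" for v
    using base by (simp add: s_base_def tropically_spans_def)
  obtain \<alpha> u1 where v1: "v1 = \<alpha> *s s + u1" and u1: "tropically_spanned (S - {s}) u1"
    using split_coefficient[OF spans] by metis
  obtain \<beta> u2 where v2: "v2 = \<beta> *s s + u2" and u2: "tropically_spanned (S - {s}) u2"
    using split_coefficient[OF spans] by metis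
  have eq: "s = (\<alpha> + \<beta>) *s s + (u1 + (u2 + h))"
    using h(2) unfolding v1 v2 scale_add_left by (simp add: ac_simps)
  have "tropically_spanned (S - {s}) (u1 + (u2 + h))"
    by (intro tropically_spanned_add u1 u2 tropically_spanned_ghost h(1))
  note coeff = self_coefficient[OF eq this indep]
  have "\<alpha> + \<beta> \<in> {\<alpha>, \<beta>}"
  proof (cases "\<alpha> = 0 \<or> \<beta> = 0")
    case False
    \<comment> \<open>Equal ghosts would make the sum a ghost, contradicting its tangibility.\<close>
    then have "ghost_map \<alpha> \<noteq> ghost_map \<beta>"
      using add_eq_ghost[of \<alpha> \<beta>] coeff(1) ghost_map_ghost[of \<alpha>] by (auto simp: tangible_def)
    then show ?thesis
      using False add_bipotent by simp
  qed auto
  then show False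
  proof (elim insertE emptyE)
    assume sum: "\<alpha> + \<beta> = \<alpha>"
    have "v1 = \<alpha> *s s"
      using summand_absorbed[OF eq] coeff tangible_nonzero v1 unfolding sum by simp
    then show False
      using v(1) coeff(1) unfolding sum proj_equiv_def by blast
  next
    assume sum: "\<alpha> + \<beta> = \<beta>"
    have "s = (\<alpha> + \<beta>) *s s + (u2 + (u1 + h))"
      using eq by (simp only: ac_simps)
    then have "v2 = \<beta> *s s"
      using summand_absorbed coeff tangible_nonzero v2 unfolding sum by simp
    then show False
      using v(2) coeff(1) unfolding sum proj_equiv_def by blast
  qed
qed

lemma critical_not_ghost:
  assumes "critical v"
  shows "v \<notin> H0"
proof
  assume "v \<in> H0"
  then have "ghost_surpasses v (0 + 0)"
    by (simp add: ghost_surpasses_def)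
  moreover have "0 \<notin> proj_class v"
    using assms proj_equiv_sym
    by (fastforce simp: proj_class_def proj_equiv_def critical_def scale_zero_right)
  ultimately show False
    using assms unfolding critical_def by blast
qed

text \<open>
  The coefficients have to vary in the induction, since they are rescaled when the remaining sum
  rather than the separated summand is equivalent to \<open>v\<close>.
\<close>

lemma critical_equiv_summand:
  assumes crit: "critical v"
    and "finite I" "\<forall>w\<in>I. c w \<in> tangible" "ghost_surpasses v (\<Sum>w\<in>I. c w *s w)"
  shows "\<exists>w\<in>I. proj_equiv v w"
  using assms(2-)
proof (induction I arbitrary: c rule: finite_induct)
  case empty
  then show ?case
    using critical_not_ghost[OF crit] by (simp add: ghost_surpasses_def)
next
  case (insert x I)
  let ?rest = "\<Sum>w\<in>I. c w *s w"
  have "ghost_surpasses v (c x *s x + ?rest)"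
    using insert by simp
  then consider "c x *s x \<in> proj_class v" | "?rest \<in> proj_class v"
    using crit unfolding critical_def by blast
  then show ?case
  proof cases
    case 1
    moreover have "proj_equiv (c x *s x) x"
      using insert.prems(1) unfolding proj_equiv_def by blast
    ultimately show ?thesis
      using proj_equiv_sym proj_equiv_trans unfolding proj_class_def by blast
  next
    case 2
    then have "proj_equiv v ?rest"
      using proj_equiv_sym unfolding proj_class_def by blast
    then obtain \<delta> where \<delta>: "\<delta> \<in> tangible" "v = \<delta> *s ?rest"
      unfolding proj_equiv_def by blast
    then have "v = (\<Sum>w\<in>I. (\<delta> * c w) *s w) + 0"
      by (simp add: scale_sum_right scale_scale)
    then have "ghost_surpasses v (\<Sum>w\<in>I. (\<delta> * c w) *s w)"
      unfolding ghost_surpasses_def using zero_ghost_vec by blast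
    then show ?thesis
      using insert.IH[of "\<lambda>w. \<delta> * c w"] insert.prems(1) \<delta>(1) mult_tangible by blast
  qed
qed

lemma critical_equiv_unique_base_element:
  assumes "s_base S" "critical v"
  shows "\<exists>!s. s \<in> S \<and> proj_equiv v s"
proof (rule ex_ex1I)
  have "tropically_spanned S v"
    using assms(1) by (simp add: s_base_def tropically_spans_def)
  then show "\<exists>s. s \<in> S \<and> proj_equiv v s"
    using critical_equiv_summand[OF assms(2)] unfolding tropically_spanned_def by blast
next
  fix s t
  assume "s \<in> S \<and> proj_equiv v s" "t \<in> S \<and> proj_equiv v t"
  then show "s = t"
    using s_base_proj_equiv_eq[OF assms(1)] proj_equiv_sym proj_equiv_trans by blast
qed

lemma s_base_tropical_critical_set:
  assumes "s_base S"
  shows "tropical_critical_set S"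
proof -
  have "\<exists>!c. c \<in> S \<inter> proj_class v" if "critical v" for v
  proof -
    have "c \<in> S \<inter> proj_class v \<longleftrightarrow> c \<in> S \<and> proj_equiv v c" for c
      using proj_equiv_sym unfolding proj_class_def by blast
    then show ?thesis
      using critical_equiv_unique_base_element[OF assms that] by simp
  qed
  then show ?thesis
    using s_base_element_critical[OF assms] unfolding tropical_critical_set_def by blast
qed

end

theorem theorem5p23:
  fixes G0 :: "'f::semiring_1 set"
    and scale :: "'f \<Rightarrow> 'v::comm_monoid_add \<Rightarrow> 'v"
    and H0 S :: "'v set"
  assumes "supertropical_vector_space G0 scale H0"
    and "supertropical_vector_space.s_base G0 scale H0 S"
  shows "supertropical_vector_space.tropical_critical_set G0 scale H0 S \<and>
    (\<forall>s\<in>S. supertropical_vector_space.critical G0 scale H0 s) \<and>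
    (\<forall>v. supertropical_vector_space.critical G0 scale H0 v \<longrightarrow>
      (\<exists>!s. s \<in> S \<and> supertropical_vector_space.proj_equiv G0 scale v s))"
proof -
  interpret supertropical_vector_space G0 scale H0
    by (fact assms(1))
  show ?thesis
    using s_base_tropical_critical_set[OF assms(2)] s_base_element_critical[OF assms(2)]
      critical_equiv_unique_base_element[OF assms(2)] by blast
qed

end
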